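(* Let $p>1$ and let $f,g,\rho,d$ satisfy the standing assumptions. Let $u$ be a traveling wave solution, defined in $(\alpha,\beta)$, with some speed $c\in\mathbb R$. Put $\varphi(u):=d(u)(\rho(u))^{p-1}$, and suppose that $\varphi$ is differentiable in a left neighborhood of $1$ and satisfies $$\varphi(1^-)=0\quad\text{and}\quad\dot\varphi(u)\to-\infty\ \text{ as }u\to1^-.$$ Then, if $\int_{1/2}^1\frac1{\rho(u)}\,du=+\infty$, we have $\alpha=-\infty$.
   Context: Standing assumptions: $p>1$; $f,g,\rho\in C[0,1]$; $d\in C^1(0,1)$; $\rho(u)>0$ in $(0,1)$ and $\rho(0)=\rho(1)=0$; $g(0)>0$ and $\int_0^u g(s)\,ds>0$ for every $u\in(0,1]$; $d(u)>0$ in $(0,1)$ and $\rho\, d^{\frac1{p-1}}\in L^1(0,1)$. A traveling wave solution (t.w.s.) with speed $c\in\mathbb R$ is a function $u\in C^1(\alpha,\beta)$, with $-\infty\le\alpha<\beta\le+\infty$, such that $0<u(t)<1$ for all $t\in(\alpha,\beta)$, $d(u)|u'|^{p-2}u'\in C^1(\alpha,\beta)$, $$(d(u)|u'|^{p-2}u')'+(cg(u)-f(u))u'+\rho(u)=0\quad\text{in }(\alpha,\beta),$$ $u(\alpha^+)=1$, $u(\beta^-)=0$, and $\lim_{t\to\alpha^+}d(u)|u'|^{p-2}u'=\lim_{t\to\beta^-}d(u)|u'|^{p-2}u'=0$. The dot denotes differentiation with respect to $u$. *)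

theory Defs
  imports "HOL-Analysis.Analysis"
begin

definition standing_assumptions ::
  "real \<Rightarrow> (real \<Rightarrow> real) \<Rightarrow> (real \<Rightarrow> real) \<Rightarrow> (real \<Rightarrow> real) \<Rightarrow> (real \<Rightarrow> real) \<Rightarrow> bool" where
  "standing_assumptions p f g \<rho> d \<longleftrightarrow>
     p > 1 \<and>
     continuous_on {0..1} f \<and> continuous_on {0..1} g \<and> continuous_on {0..1} \<rho> \<and>
     d C1_differentiable_on {0<..<1} \<and>
     (\<forall>v\<in>{0<..<1}. \<rho> v > 0) \<and> \<rho> 0 = 0 \<and> \<rho> 1 = 0 \<and>
     g 0 > 0 \<and> (\<forall>v\<in>{0<..1}. integral {0..v} g > 0) \<and>
     (\<forall>v\<in>{0<..<1}. d v > 0) \<and>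
     set_integrable lborel {0<..<1} (\<lambda>v. \<rho> v * d v powr (1 / (p - 1)))"

text \<open>The flux \<open>d(u) |u'|^(p-2) u'\<close>. Since \<open>0 powr x = 0\<close>, it vanishes where
  \<open>u' = 0\<close>, for every \<open>p > 1\<close>.\<close>

definition flux :: "real \<Rightarrow> (real \<Rightarrow> real) \<Rightarrow> (real \<Rightarrow> real) \<Rightarrow> real \<Rightarrow> real" where
  "flux p d u t = d (u t) * \<bar>deriv u t\<bar> powr (p - 2) * deriv u t"

text \<open>The endpoints are extended reals. One-sided limits at an endpoint are taken in \<^typ>\<open>ereal\<close>
  after composition with \<^const>\<open>real_of_ereal\<close>; they are limits at \<open>\<plusminus>\<infinity>\<close> when the endpoint is
  infinite. Only the values of \<open>u\<close> on the open interval matter.\<close>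

definition travelling_wave ::
  "real \<Rightarrow> (real \<Rightarrow> real) \<Rightarrow> (real \<Rightarrow> real) \<Rightarrow> (real \<Rightarrow> real) \<Rightarrow> (real \<Rightarrow> real) \<Rightarrow>
   real \<Rightarrow> ereal \<Rightarrow> ereal \<Rightarrow> (real \<Rightarrow> real) \<Rightarrow> bool" where
  "travelling_wave p f g \<rho> d c \<alpha> \<beta> u \<longleftrightarrow>
     \<alpha> < \<beta> \<and>
     u C1_differentiable_on einterval \<alpha> \<beta> \<and>
     (\<forall>t\<in>einterval \<alpha> \<beta>. 0 < u t \<and> u t < 1) \<and>
     flux p d u C1_differentiable_on einterval \<alpha> \<beta> \<and>
     (\<forall>t\<in>einterval \<alpha> \<beta>.
        deriv (flux p d u) t + (c * g (u t) - f (u t)) * deriv u t + \<rho> (u t) = 0) \<and>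
     ((u \<circ> real_of_ereal) \<longlongrightarrow> 1) (at_right \<alpha>) \<and>
     ((u \<circ> real_of_ereal) \<longlongrightarrow> 0) (at_left \<beta>) \<and>
     ((flux p d u \<circ> real_of_ereal) \<longlongrightarrow> 0) (at_right \<alpha>) \<and>
     ((flux p d u \<circ> real_of_ereal) \<longlongrightarrow> 0) (at_left \<beta>)"

definition phi :: "real \<Rightarrow> (real \<Rightarrow> real) \<Rightarrow> (real \<Rightarrow> real) \<Rightarrow> real \<Rightarrow> real" where
  "phi p \<rho> d v = d v * \<rho> v powr (p - 1)"

end

theory Submission
  imports Defs
begin

text \<open>If \<open>\<alpha>\<close> were finite, compare the flux with \<open>\<phi>(u)\<close> along the wave. Put
  \<open>s(t) = - d(u) |u'|^(p-2) u' - \<phi>(u)\<close>. Where \<open>s > 0\<close> one has \<open>- u' > \<rho>(u)\<close>, and then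
  \<open>s' = u' (c g(u) - f(u) - \<phi>'(u)) + \<rho>(u) < 0\<close> as soon as \<open>u\<close> is so close to \<open>1\<close> that
  \<open>- \<phi>'(u)\<close> exceeds the bounded term. A function that decreases where it is positive and tends
  to \<open>0\<close> at \<open>\<alpha>\<close> is nonpositive, so \<open>- u' \<le> \<rho>(u)\<close> near \<open>\<alpha>\<close>. Hence
  \<open>t + \<integral> 1/\<rho>\<close> (from \<open>1/2\<close> to \<open>u(t)\<close>) is nondecreasing, which bounds the integral of
  \<open>1/\<rho>\<close> up to \<open>1\<close>.\<close>

text \<open>Passes from gauge integrals over compact subintervals to the Lebesgue integral over the
  half-open interval: the measure with density \<open>h\<close> is continuous from below along an
  exhausting sequence.\<close>

lemma set_nn_integral_le_of_integral_le:
  fixes h :: "real \<Rightarrow> real"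
  assumes cont: "continuous_on {a..<b} h" and nonneg: "\<And>x. x \<in> {a..<b} \<Longrightarrow> 0 \<le> h x"
    and bound: "\<And>v. v \<in> {a..<b} \<Longrightarrow> integral {a..v} h \<le> B" and "a < b"
  shows "(\<integral>\<^sup>+ x\<in>{a..<b}. ennreal (h x) \<partial>lborel) \<le> ennreal B"
proof -
  define H where "H x = ennreal (indicator {a..<b} x * h x)" for x
  define M where "M = density lborel H"
  \<comment> \<open>This sequence starts at \<open>a\<close> and increases to \<open>b\<close>
    without reaching it.\<close>
  define v where "v n = b - (b - a) / real (Suc n)" for n
  have v_mem: "v n \<in> {a..<b}" for n
  proof -
    have "(b - a) / real (Suc n) \<le> (b - a) / 1"
      using \<open>a < b\<close> by (intro divide_left_mono) auto
    then show ?thesis using \<open>a < b\<close> by (auto simp: v_def)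
  qed
  have "incseq v"
    using \<open>a < b\<close> by (auto simp: v_def intro!: incseq_SucI divide_left_mono)
  have "(\<lambda>x. indicator {a..<b} x *\<^sub>R h x) \<in> borel_measurable borel"
    by (intro borel_measurable_continuous_on_indicator cont) auto
  then have H_meas: "H \<in> borel_measurable lborel"
    by (simp add: H_def[abs_def])
  have Un: "(\<Union>n. {a..v n}) = {a..<b}"
  proof (intro equalityI subsetI)
    fix x assume x: "x \<in> {a..<b}"
    \<comment> \<open>The inequality is \<open>x < v n\<close> rearranged.\<close>
    then obtain n where "inverse (real (Suc n)) < (b - x) / (b - a)"
      using reals_Archimedean[of "(b - x) / (b - a)"] \<open>a < b\<close> by auto
    then have "x \<le> v n"
      using \<open>a < b\<close> by (simp add: v_def field_simps)
    then show "x \<in> (\<Union>n. {a..v n})" using x by auto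
  next
    fix x assume "x \<in> (\<Union>n. {a..v n})"
    then obtain n where "a \<le> x" "x \<le> v n" by auto
    then show "x \<in> {a..<b}" using v_mem[of n] by auto
  qed
  have le: "emeasure M {a..v n} \<le> ennreal B" for n
  proof -
    have sub: "{a..v n} \<subseteq> {a..<b}" using v_mem[of n] by auto
    then have int: "set_integrable lborel {a..v n} h"
      by (intro borel_integrable_atLeastAtMost' continuous_on_subset[OF cont])
    have "emeasure M {a..v n} = (\<integral>\<^sup>+ x. ennreal (indicator {a..v n} x *\<^sub>R h x) \<partial>lborel)"
      unfolding M_def using sub
      by (subst emeasure_density[OF H_meas])
        (auto simp: H_def intro!: nn_integral_cong split: split_indicator)
    also have "\<dots> = ennreal (LINT x:{a..v n}|lborel. h x)"
      unfolding set_lebesgue_integral_def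
      using int sub nonneg unfolding set_integrable_def
      by (intro nn_integral_eq_integral AE_I2) (auto split: split_indicator)
    also have "\<dots> = ennreal (integral {a..v n} h)"
      using set_borel_integral_eq_integral(2)[OF int] by simp
    also have "\<dots> \<le> ennreal B"
      using bound[OF v_mem] by (rule ennreal_leI)
    finally show ?thesis .
  qed
  have "(\<integral>\<^sup>+ x\<in>{a..<b}. ennreal (h x) \<partial>lborel) = emeasure M {a..<b}"
    unfolding M_def
    by (subst emeasure_density[OF H_meas])
      (auto simp: H_def intro!: nn_integral_cong split: split_indicator)
  also have "\<dots> = (SUP n. emeasure M {a..v n})"
    unfolding Un[symmetric]
    by (rule SUP_emeasure_incseq[symmetric])
      (use \<open>incseq v\<close> in \<open>auto simp: M_def incseq_def intro: order_trans\<close>)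
  also have "\<dots> \<le> ennreal B" by (rule SUP_least) (rule le)
  finally show ?thesis .
qed

text \<open>Were \<open>s\<close> positive at \<open>t0\<close>, it could only be larger further
  left, so it would stay above \<open>s t0 > 0\<close> all the way to \<open>a\<close>, against its
  limit 0.\<close>

lemma nonpos_if_decreasing_where_pos:
  fixes s :: "real \<Rightarrow> real"
  assumes lim: "(s \<longlongrightarrow> 0) (at_right a)" and cont: "continuous_on {a<..<b} s"
    and dec: "\<And>t. t \<in> {a<..<b} \<Longrightarrow> s t > 0 \<Longrightarrow> \<exists>D<0. (s has_real_derivative D) (at t)"
    and t0: "t0 \<in> {a<..<b}"
  shows "s t0 \<le> 0"
proof (rule ccontr)
  assume "\<not> s t0 \<le> 0"
  then have pos: "s t0 > 0" by simp
  have ge: "s t \<ge> s t0" if t: "t \<in> {a<..<t0}" for t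
  proof (rule ccontr)
    assume less: "\<not> s t \<ge> s t0"
    have "continuous_on {t..t0} s"
      by (rule continuous_on_subset[OF cont]) (use t t0 in auto)
    \<comment> \<open>A maximum at the left end \<open>t\<close> would give
      \<open>s t \<ge> s t0\<close>. So \<open>m\<close> lies to the right of \<open>t\<close>,
      where \<open>s\<close> is positive and decreasing, and points just left of \<open>m\<close>
      exceed the maximum.\<close>
    then obtain m where m: "m \<in> {t..t0}" "\<And>x. x \<in> {t..t0} \<Longrightarrow> s x \<le> s m"
      using continuous_attains_sup[of "{t..t0}" s] t by auto
    have "s m \<ge> s t0" using m t by simp
    with less have "t < m" using m(1) by (cases "t = m") auto
    have "m \<in> {a<..<b}" using m(1) t t0 by auto
    then obtain D where "D < 0" "(s has_real_derivative D) (at m)"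
      using dec[of m] pos \<open>s m \<ge> s t0\<close> by auto
    then obtain e where e: "e > 0" "\<And>h. 0 < h \<Longrightarrow> h < e \<Longrightarrow> s m < s (m - h)"
      using DERIV_neg_dec_left by blast
    define h where "h = min (e / 2) (m - t)"
    have "0 < h" "h < e" "m - h \<in> {t..t0}"
      using \<open>t < m\<close> e(1) m(1) by (auto simp: h_def min_def)
    then show False using e(2)[of h] m(2)[of "m - h"] by simp
  qed
  have "\<forall>\<^sub>F t in at_right a. s t \<ge> s t0"
    using t0 ge by (auto simp: eventually_at_right_field)
  then have "0 \<ge> s t0"
    using tendsto_lowerbound[OF lim] by simp
  with pos show False by simp
qed

text \<open>For \<open>x < 0\<close> the flux is \<open>- \<delta> * (- x) powr (p - 1)\<close> and
  the power is strictly increasing; for \<open>x \<ge> 0\<close> both inequalities fail by sign.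
  This turns a comparison of fluxes into one of slopes.\<close>

lemma neg_p_laplace_gt_iff:
  fixes p \<delta> r x :: real
  assumes "p > 1" "\<delta> > 0" "r \<ge> 0"
  shows "\<delta> * r powr (p - 1) < - (\<delta> * \<bar>x\<bar> powr (p - 2) * x) \<longleftrightarrow> r < - x"
proof (cases "x < 0")
  case True
  then have "\<bar>x\<bar> powr (p - 2) * (- x) = (- x) powr (p - 1)"
    using powr_add[of "- x" "p - 2" 1] by simp
  then have "- (\<delta> * \<bar>x\<bar> powr (p - 2) * x) = \<delta> * (- x) powr (p - 1)"
    by (metis mult.assoc mult_minus_right)
  moreover have "r powr (p - 1) < (- x) powr (p - 1) \<longleftrightarrow> r < - x"
    using assms True powr_less_mono2[of "p - 1" r "- x"] powr_mono2[of "p - 1" "- x" r]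
    by (meson diff_gt_0_iff_gt less_imp_le neg_0_less_iff_less not_le)
  ultimately show ?thesis using assms(2) by simp
next
  case False
  then have "\<delta> * \<bar>x\<bar> powr (p - 2) * x \<ge> 0" "\<delta> * r powr (p - 1) \<ge> 0"
    using assms by simp_all
  then show ?thesis using False assms(3) by linarith
qed

lemma C1_differentiable_on_imp_DERIV:
  fixes u :: "real \<Rightarrow> real"
  assumes "u C1_differentiable_on S" "t \<in> S"
  shows "(u has_real_derivative deriv u t) (at t)"
  using assms
  by (metis C1_differentiable_on_def has_real_derivative_iff_has_vector_derivative DERIV_imp_deriv)


text \<open>With \<open>R\<close> a primitive of \<open>1 / \<rho>\<close>, the slope bound makes
  \<open>R (u t) + t\<close> nondecreasing; since \<open>t\<close> stays above the finite
  \<open>a\<close>, \<open>R\<close> is bounded along \<open>u\<close>, whose values approach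
  \<open>r\<close>.\<close>

lemma set_nn_integral_inverse_finite:
  fixes \<rho> u u' :: "real \<Rightarrow> real"
  assumes \<rho>_cont: "continuous_on {l..<r} \<rho>" and \<rho>_pos: "\<And>v. v \<in> {l..<r} \<Longrightarrow> \<rho> v > 0"
    and lim: "(u \<longlongrightarrow> r) (at_right a)" and "a < b" "l < r"
    and u_range: "\<And>t. t \<in> {a<..<b} \<Longrightarrow> u t \<in> {l<..<r}"
    and u_deriv: "\<And>t. t \<in> {a<..<b} \<Longrightarrow> (u has_real_derivative u' t) (at t)"
    and slow: "\<And>t. t \<in> {a<..<b} \<Longrightarrow> - u' t \<le> \<rho> (u t)"
  shows "(\<integral>\<^sup>+ v\<in>{l..<r}. ennreal (1 / \<rho> v) \<partial>lborel) < \<infinity>"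
proof -
  define R where "R v = integral {l..v} (\<lambda>v. 1 / \<rho> v)" for v
  have cont: "continuous_on {l..<r} (\<lambda>v. 1 / \<rho> v)"
    using \<rho>_pos by (intro continuous_intros \<rho>_cont) force
  have int: "(\<lambda>v. 1 / \<rho> v) integrable_on {l..v}" if "v < r" for v
    using that by (intro integrable_continuous_real continuous_on_subset[OF cont]) auto
  have R_deriv: "(R has_real_derivative 1 / \<rho> v) (at v)" if v: "v \<in> {l<..<r}" for v
  proof -
    \<comment> \<open>The fundamental theorem gives a derivative within a closed interval; ending it
      at \<open>w\<close> makes \<open>v\<close> an interior point and keeps it away from
      \<open>r\<close>.\<close>
    obtain w where w: "v < w" "w < r" using v dense by auto
    have "(R has_real_derivative 1 / \<rho> v) (at v within {l..w})"
      unfolding R_def using v w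
      by (intro integral_has_real_derivative continuous_on_subset[OF cont]) auto
    then show ?thesis
      using v w by (simp add: at_within_Icc_at)
  qed
  define t1 where "t1 = (a + b) / 2"
  have t1: "t1 \<in> {a<..<b}" using \<open>a < b\<close> by (auto simp: t1_def)
  \<comment> \<open>Monotonicity gives \<open>R (u t) \<le> R (u t1) + t1 - t\<close>, and
    \<open>t > a\<close> removes the dependence on \<open>t\<close>.\<close>
  define B where "B = R (u t1) + t1 - a"
  have R_u: "R (u t) \<le> B" if t: "t \<in> {a<..<t1}" for t
  proof -
    have "R (u t) + t \<le> R (u t1) + t1"
    proof (rule DERIV_nonneg_imp_nondecreasing[of t t1 "\<lambda>t. R (u t) + t"])
      fix x assume "t \<le> x" "x \<le> t1"
      then have x: "x \<in> {a<..<b}" using t t1 by auto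
      have "((\<lambda>t. R (u t) + t) has_real_derivative 1 / \<rho> (u x) * u' x + 1) (at x)"
        by (intro derivative_intros DERIV_chain2[OF R_deriv[OF u_range[OF x]] u_deriv[OF x]])
      moreover have "1 / \<rho> (u x) * u' x + 1 \<ge> 0"
        using slow[OF x] \<rho>_pos[of "u x"] u_range[OF x] by (simp add: field_simps)
      ultimately show "\<exists>y. ((\<lambda>t. R (u t) + t) has_real_derivative y) (at x) \<and> 0 \<le> y" by blast
    qed (use t in auto)
    then show ?thesis using t by (simp add: B_def)
  qed
  have "integral {l..v} (\<lambda>v. 1 / \<rho> v) \<le> B" if v: "v \<in> {l..<r}" for v
  proof -
    have "\<forall>\<^sub>F t in at_right a. v < u t"
      using order_tendstoD(1)[OF lim] v by auto
    moreover have "\<forall>\<^sub>F t in at_right a. t \<in> {a<..<t1}"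
      using t1 by (intro eventually_at_right_real) auto
    ultimately have "\<forall>\<^sub>F t in at_right a. v < u t \<and> t \<in> {a<..<t1}"
      by (rule eventually_conj)
    then obtain t where t: "v < u t" "t \<in> {a<..<t1}"
      using eventually_happens'[OF trivial_limit_at_right_real] by blast
    have "u t \<in> {l<..<r}" using u_range t(2) t1 by auto
    then have "integral {l..v} (\<lambda>v. 1 / \<rho> v) \<le> R (u t)"
      unfolding R_def using t(1) v \<rho>_pos
      by (intro integral_subset_le int) (auto simp: less_imp_le)
    with R_u[OF t(2)] show ?thesis by simp
  qed
  then have "(\<integral>\<^sup>+ v\<in>{l..<r}. ennreal (1 / \<rho> v) \<partial>lborel) \<le> ennreal B"
    using \<rho>_pos \<open>l < r\<close> by (intro set_nn_integral_le_of_integral_le cont) (auto simp: less_imp_le)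
  then show ?thesis
    by (rule le_less_trans) simp
qed

theorem theorem19:
  fixes p c :: real and f g \<rho> d u :: "real \<Rightarrow> real" and \<alpha> \<beta> :: ereal
  assumes "standing_assumptions p f g \<rho> d"
    and "travelling_wave p f g \<rho> d c \<alpha> \<beta> u"
    and "\<forall>\<^sub>F v in at_left 1. phi p \<rho> d differentiable at v"
    and "(phi p \<rho> d \<longlongrightarrow> 0) (at_left 1)"
    and "filterlim (deriv (phi p \<rho> d)) at_bot (at_left 1)"
    and "(\<integral>\<^sup>+ v\<in>{1/2..<1}. ennreal (1 / \<rho> v) \<partial>lborel) = \<infinity>"
  shows "\<alpha> = - \<infinity>"
proof (rule ccontr)
  assume "\<alpha> \<noteq> - \<infinity>"
  moreover have "\<alpha> < \<beta>" using assms(2) by (simp add: travelling_wave_def)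
  ultimately obtain a where a: "\<alpha> = ereal a" by (cases \<alpha>) auto
  let ?\<phi> = "phi p \<rho> d" and ?w = "flux p d u"
  have "p > 1" and d_pos: "\<And>v. v \<in> {0<..<1} \<Longrightarrow> d v > 0"
    and \<rho>_pos: "\<And>v. v \<in> {0<..<1} \<Longrightarrow> \<rho> v > 0" and \<rho>_cont: "continuous_on {0..1} \<rho>"
    and fg_cont: "continuous_on {0..1} f" "continuous_on {0..1} g"
    using assms(1) by (auto simp: standing_assumptions_def)
  note tw = assms(2)[unfolded travelling_wave_def a ereal_tendsto_simps1]
  have u_lim: "(u \<longlongrightarrow> 1) (at_right a)" and w_lim: "(?w \<longlongrightarrow> 0) (at_right a)"
    using tw by auto

  have "continuous_on {0..1} (\<lambda>v. c * g v - f v)"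
    by (intro continuous_intros fg_cont)
  then obtain M where M: "\<And>v. v \<in> {0..1} \<Longrightarrow> \<bar>c * g v - f v\<bar> \<le> M"
    using compact_imp_bounded[OF compact_continuous_image[OF _ compact_Icc]]
    by (metis (no_types, lifting) bounded_iff image_eqI real_norm_def)
  \<comment> \<open>The bound \<open>- M - 1\<close> makes
    \<open>c * g v - f v - deriv ?\<phi> v\<close> at least 1; \<open>1 / 2 < v\<close> places the
    wave in the range of the divergent integral.\<close>
  have "\<forall>\<^sub>F v in at_left 1. ?\<phi> differentiable at v \<and> deriv ?\<phi> v \<le> - M - 1 \<and> 1 / 2 < v"
    using assms(5)[unfolded filterlim_at_bot] eventually_at_left_real[of "1/2" "1::real"]
    by (intro eventually_conj assms(3)) (auto elim: eventually_mono)
  then obtain v1 where v1: "v1 < 1"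
    "\<And>v. v \<in> {v1<..<1} \<Longrightarrow> ?\<phi> differentiable at v \<and> deriv ?\<phi> v \<le> - M - 1 \<and> 1 / 2 < v"
    by (auto simp: eventually_at_left_field)
  obtain b0 where b0: "a < b0" "ereal b0 < \<beta>"
    using \<open>\<alpha> < \<beta>\<close> a ereal_dense2 by (metis ereal_less_eq(3) less_ereal.simps(1))
  have "\<forall>\<^sub>F t in at_right a. v1 < u t \<and> t < b0"
    using order_tendstoD(1)[OF u_lim v1(1)] eventually_at_right_real[OF b0(1)]
    by (auto elim: eventually_elim2)
  then obtain b where b: "a < b" "\<And>t. t \<in> {a<..<b} \<Longrightarrow> v1 < u t \<and> t < b0"
    by (auto simp: eventually_at_right_field)

  have mem: "t \<in> einterval \<alpha> \<beta>" if "t \<in> {a<..<b}" for t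
    using b(2)[OF that] that b0(2) less_trans[of "ereal t" "ereal b0" \<beta>]
    by (auto simp: einterval_def a)
  have u1: "u t < 1" "u t > 0" "u t \<in> {v1<..<1}" if "t \<in> {a<..<b}" for t
    using mem[OF that] tw b(2)[OF that] a by auto
  have u_half: "u t > 1 / 2" if "t \<in> {a<..<b}" for t
    using v1(2) u1(3)[OF that] by blast
  have u_deriv: "(u has_real_derivative deriv u t) (at t)"
    and w_deriv: "(?w has_real_derivative deriv ?w t) (at t)" if "t \<in> {a<..<b}" for t
    using tw mem[OF that] a by (auto intro: C1_differentiable_on_imp_DERIV)
  have ode: "deriv ?w t = - (c * g (u t) - f (u t)) * deriv u t - \<rho> (u t)"
    if "t \<in> {a<..<b}" for t
    using tw mem[OF that] a by (fastforce simp: algebra_simps)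

  define s where "s t = - ?w t - ?\<phi> (u t)" for t
  have s_pos_iff: "s t > 0 \<longleftrightarrow> \<rho> (u t) < - deriv u t" if "t \<in> {a<..<b}" for t
    using neg_p_laplace_gt_iff[OF \<open>p > 1\<close> d_pos[of "u t"], of "\<rho> (u t)" "deriv u t"]
      u1[OF that] \<rho>_pos[of "u t"]
    by (auto simp: s_def flux_def phi_def)
  have s_deriv: "(s has_real_derivative - deriv ?w t - deriv ?\<phi> (u t) * deriv u t) (at t)"
    if "t \<in> {a<..<b}" for t
  proof -
    have "(?\<phi> has_real_derivative deriv ?\<phi> (u t)) (at (u t))"
      using v1(2) u1(3)[OF that] by (simp add: DERIV_deriv_iff_real_differentiable)
    from DERIV_chain2[OF this u_deriv[OF that]] show ?thesis
      unfolding s_def by (intro derivative_intros w_deriv[OF that])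
  qed
  \<comment> \<open>Approach from strictly below 1 is what allows composing with the left limit of
    \<open>?\<phi>\<close>.\<close>
  have "\<forall>\<^sub>F t in at_right a. u t < 1"
    using u1(1) b(1) by (auto simp: eventually_at_right_field)
  then have "filterlim u (at_left 1) (at_right a)"
    using u_lim by (auto simp: filterlim_at elim: eventually_mono)
  from tendsto_diff[OF tendsto_minus[OF w_lim] filterlim_compose[OF assms(4) this]]
  have s_lim: "(s \<longlongrightarrow> 0) (at_right a)" by (simp add: s_def[abs_def])
  have "s t \<le> 0" if t: "t \<in> {a<..<b}" for t
  proof (rule nonpos_if_decreasing_where_pos[OF s_lim _ _ t])
    show "continuous_on {a<..<b} s"
      using s_deriv DERIV_isCont by (blast intro: continuous_at_imp_continuous_on)
    fix t assume t: "t \<in> {a<..<b}" and "s t > 0"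
    then have less: "\<rho> (u t) < - deriv u t" using s_pos_iff by blast
    have "\<rho> (u t) > 0" using \<rho>_pos u1[OF t] by simp
    \<comment> \<open>By the equation,
      \<open>s' = (c g(u) - f(u) - \<phi>'(u)) u' + \<rho>(u)\<close>. The bracket is at least 1 and
      \<open>u' < 0\<close>, so \<open>s' \<le> u' + \<rho>(u) < 0\<close>.\<close>
    have "c * g (u t) - f (u t) - deriv ?\<phi> (u t) \<ge> 1"
      using M[of "u t"] v1(2)[OF u1(3)[OF t]] u1[OF t] by force
    then have "1 * (- deriv u t) \<le> (c * g (u t) - f (u t) - deriv ?\<phi> (u t)) * (- deriv u t)"
      using less \<open>\<rho> (u t) > 0\<close> by (intro mult_right_mono) auto
    then have "- deriv ?w t - deriv ?\<phi> (u t) * deriv u t < 0"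
      using less by (simp add: ode[OF t] algebra_simps)
    with s_deriv[OF t] show "\<exists>D<0. (s has_real_derivative D) (at t)" by blast
  qed
  then have "- deriv u t \<le> \<rho> (u t)" if "t \<in> {a<..<b}" for t
    using s_pos_iff[OF that] that by force
  \<comment> \<open>Here \<open>l = 1/2\<close> and \<open>r = 1\<close>; the half-open interval
    avoids the zero of \<open>\<rho>\<close> at 1.\<close>
  then have "(\<integral>\<^sup>+ v\<in>{1/2..<1}. ennreal (1 / \<rho> v) \<partial>lborel) < \<infinity>"
    using u_lim b(1) u_half u1(1) u_deriv \<rho>_pos
    by (intro set_nn_integral_inverse_finite[where u = u and a = a and b = b]
        continuous_on_subset[OF \<rho>_cont]) auto
  with assms(6) show False by simp
qed

end
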